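(* For every pair of integers $r\ge 2$ and $m\ge 1$, there exist a finite set $V$ and an admissible function $w:2^V\to\mathbb{R}_{\ge0}$ such that $$\delta(w)\le\frac1m+\frac{m-1}{mr}.$$
   Context: Let $V$ be a finite set and $2^V$ its power set. A function $w:2^V\to\mathbb{R}_{\ge0}$ is called admissible if it is not identically zero, $w(\varnothing)=0$, and $w(A\cup B)\ge\min\{w(A),w(B)\}$ for all $A,B\subseteq V$. For an admissible $w$ and $x\in V$ put $p_x(w)=\dfrac{\sum_{A\subseteq V,\,x\in A}w(A)}{\sum_{A\subseteq V}w(A)}$, and $\delta(w)=\max_{x\in V}p_x(w)$. (An admissible function can exist only if $V\neq\varnothing$.) *)

theory Defs
  imports Complex_Main
begin

text \<open>
  A weight function on the power set of \<open>V\<close> is a function \<open>w :: 'a set \<Rightarrow> real\<close> whose values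
  outside \<open>Pow V\<close> are irrelevant: everything below only looks at \<open>w\<close> on subsets of \<open>V\<close>.
\<close>

definition admissible :: "'a set \<Rightarrow> ('a set \<Rightarrow> real) \<Rightarrow> bool" where
  "admissible V w \<longleftrightarrow>
     (\<forall>A\<in>Pow V. 0 \<le> w A) \<and>
     (\<exists>A\<in>Pow V. w A \<noteq> 0) \<and>
     w {} = 0 \<and>
     (\<forall>A\<in>Pow V. \<forall>B\<in>Pow V. min (w A) (w B) \<le> w (A \<union> B))"

definition frequency :: "'a set \<Rightarrow> ('a set \<Rightarrow> real) \<Rightarrow> 'a \<Rightarrow> real" where
  "frequency V w x = (\<Sum>A\<in>{A\<in>Pow V. x \<in> A}. w A) / (\<Sum>A\<in>Pow V. w A)"

text \<open>
  The maximum is only meaningful for finite nonempty \<open>V\<close>; an admissible function on \<open>V\<close>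
  forces \<open>V\<close> to be nonempty.
\<close>

definition max_frequency :: "'a set \<Rightarrow> ('a set \<Rightarrow> real) \<Rightarrow> real" where
  "max_frequency V w = Max (frequency V w ` V)"

end

theory Submission
  imports Defs "HOL-Library.FuncSet" "HOL-Library.Countable"
begin

text \<open>
  The weight is a sum of \<open>m\<close> nested union-closed levels, each of total mass \<open>1\<close>, arranged so
  that every element has frequency at most \<open>1/r\<close> in all levels but one. To add a level, replace
  each element by \<open>N\<close> copies and regard each copy as the rarest element of a chain of \<open>r + 1\<close>
  sets (with \<open>r\<close> nonempty members). The new level consists of the nonempty products of chain
  members together with their unions with the sets of the old levels. An old element has
  frequency \<open>1/(r+1)\<close> in the product. An old set has at least \<open>N\<close> elements, and its unions
  with product sets have one state fewer at each of them; so for large \<open>N\<close> these unions form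
  such a small part of the level that the frequency stays below \<open>1/r\<close>. The elements
  introduced with the level have weight \<open>0\<close> in the earlier ones.
\<close>

section \<open>Union-closed products of chains\<close>

text \<open>
  Over each \<open>u \<in> U\<close>, the final segment of the chain \<open>{..<r}\<close> from \<open>c u\<close> on (empty for
  \<open>c u = r\<close>). The old element is \<open>(u, 0)\<close>, present only when \<open>c u = 0\<close>.
\<close>

definition staircase :: "'a set \<Rightarrow> nat \<Rightarrow> ('a \<Rightarrow> nat) \<Rightarrow> ('a \<times> nat) set" where
  "staircase U r c = {(u, j). u \<in> U \<and> c u \<le> j \<and> j < r}"

lemma staircase_subset: "staircase U r c \<subseteq> U \<times> {..<r}"
  by (auto simp: staircase_def)

lemma staircase_Un:
  "staircase U r c \<union> staircase U r d = staircase U r (\<lambda>u\<in>U. min (c u) (d u))"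
  by (auto simp: staircase_def)

text \<open>The least second coordinate over \<open>u\<close> recovers \<open>c u\<close>, and an
  empty fibre means \<open>c u = r\<close>. For finite \<open>U\<close> there are thus
  \<open>(r + 1) ^ card U\<close> staircases, the main term of the count below.\<close>

lemma inj_on_staircase: "inj_on (staircase U r) (U \<rightarrow>\<^sub>E {..r})"
proof (rule inj_onI)
  fix c d assume c: "c \<in> U \<rightarrow>\<^sub>E {..r}" and d: "d \<in> U \<rightarrow>\<^sub>E {..r}"
    and eq: "staircase U r c = staircase U r d"
  have mem: "(u, j) \<in> staircase U r e \<longleftrightarrow> e u \<le> j \<and> j < r" if "u \<in> U" for u j e
    using that by (simp add: staircase_def)
  show "c = d"
  proof (rule PiE_ext[OF c d])
    fix u assume u: "u \<in> U"
    have "c u \<le> r" "d u \<le> r" using c d u by auto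
    moreover have "c u \<le> j \<and> j < r \<longleftrightarrow> d u \<le> j \<and> j < r" for j
      using mem[OF u, of j c] mem[OF u, of j d] eq by simp
    from this[of "c u"] this[of "d u"]
    show "c u = d u" using calculation by linarith
  qed
qed

text \<open>Over a point of \<open>A\<close> the states \<open>0\<close> and \<open>1\<close> differ
  only in the bottom pair, which \<open>A \<times> {0}\<close> supplies anyway. Merging them leaves
  \<open>r\<close> states in place of \<open>r + 1\<close>.\<close>

lemma staircase_Un_bottom:
  assumes "A \<subseteq> U" "r \<ge> 1"
  shows "staircase U r c \<union> A \<times> {0} =
    staircase U r (\<lambda>v\<in>U. if v \<in> A then max 1 (c v) else c v) \<union> A \<times> {0}"
  using assms by (auto simp: staircase_def split: if_splits)

section \<open>Counting a family with rare bottom elements\<close>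

lemma card_PiE_if:
  assumes "finite U" "A \<subseteq> U"
  shows "card (PiE U (\<lambda>v. if v \<in> A then X else Y)) = card X ^ card A * card Y ^ (card U - card A)"
proof -
  have "card (PiE U (\<lambda>v. if v \<in> A then X else Y)) = (\<Prod>v\<in>U. if v \<in> A then card X else card Y)"
    using assms by (simp add: card_PiE if_distrib)
  also have "\<dots> = card X ^ card (U \<inter> A) * card Y ^ card (U \<inter> - A)"
    using assms by (simp add: prod.If_cases)
  also have "U \<inter> A = A" using assms by auto
  also have "U \<inter> - A = U - A" by auto
  finally show ?thesis using assms by (simp add: card_Diff_subset finite_subset)
qed

text \<open>Only a fraction \<open>1 / (r + 1)\<close> of the staircases contains
  \<open>(u, 0)\<close>, which leaves slack below \<open>1 / r\<close>. The unions with members of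
  \<open>S\<close> number at most \<open>card S * r ^ N * (r + 1) ^ (card U - N)\<close>, and
  \<open>few\<close> makes them fit into this slack.\<close>

lemma rare_bottom_family:
  fixes U :: "'a set" and r N :: nat
  assumes fin: "finite U" and SU: "S \<subseteq> Pow U" and S_ne: "S \<noteq> {}"
    and un: "\<And>A B. A \<in> S \<Longrightarrow> B \<in> S \<Longrightarrow> A \<union> B \<in> S"
    and r: "r \<ge> 1" and N: "N \<ge> 2" and large: "\<And>A. A \<in> S \<Longrightarrow> N \<le> card A"
    and few: "2 * card S * r * (r + 1) * r ^ N \<le> (r + 1) ^ N"
  obtains F where "F \<subseteq> Pow (U \<times> {..<r})" "{} \<notin> F" "F \<noteq> {}"
    "\<forall>A\<in>F. \<forall>B\<in>F. A \<union> B \<in> F" "\<forall>A\<in>S. A \<times> {0} \<in> F"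
    "\<forall>u\<in>U. r * card {B \<in> F. (u, 0) \<in> B} \<le> card F"
proof -
  define st where "st = staircase U r"
  define E where "E = (U \<rightarrow>\<^sub>E {..r})"
  \<comment> \<open>\<open>A = {}\<close> gives the plain staircases, and \<open>c\<close>
    constantly \<open>r\<close> gives the sets \<open>A \<times> {0}\<close>.\<close>
  define F where "F = {st c \<union> A \<times> {0} | c A. c \<in> E \<and> A \<in> insert {} S} - {{}}"
  define n where "n = card U"
  define R where "R = r + 1"
  have finS: "finite S" using SU fin by (meson finite_Pow_iff finite_subset)
  obtain A0 where A0: "A0 \<in> S" using S_ne by auto
  have Nn: "N \<le> n" using large[OF A0] card_mono[OF fin, of A0] A0 SU by (auto simp: n_def)
  have FX: "F \<subseteq> Pow (U \<times> {..<r})"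
    using SU r staircase_subset[of U r] by (fastforce simp: F_def st_def)
  have finF: "finite F" by (rule finite_subset[OF FX]) (simp add: fin)
  have S0: "A \<union> B \<in> insert {} S" if "A \<in> insert {} S" "B \<in> insert {} S" for A B
    using that un by auto
  have FU: "B \<union> B' \<in> F" if B: "B \<in> F" and B': "B' \<in> F" for B B'
  proof -
    obtain c A where 1: "B = st c \<union> A \<times> {0}" "c \<in> E" "A \<in> insert {} S"
      using B unfolding F_def by blast
    obtain c' A' where 2: "B' = st c' \<union> A' \<times> {0}" "c' \<in> E" "A' \<in> insert {} S"
      using B' unfolding F_def by blast
    define d where "d = (\<lambda>u\<in>U. min (c u) (c' u))"
    have "B \<union> B' = (st c \<union> st c') \<union> (A \<union> A') \<times> {0}" using 1 2 by blast
    also have "st c \<union> st c' = st d" by (simp add: st_def staircase_Un d_def)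
    finally have "B \<union> B' = st d \<union> (A \<union> A') \<times> {0}" .
    moreover have "d \<in> E" using 1 2 by (auto simp: E_def d_def PiE_def Pi_def min_le_iff_disj)
    moreover have "A \<union> A' \<in> insert {} S" using S0 1 2 by blast
    moreover have "B \<union> B' \<noteq> {}" using B by (auto simp: F_def)
    ultimately show ?thesis unfolding F_def by blast
  qed
  have old: "A \<times> {0} \<in> F" if A: "A \<in> S" for A
  proof -
    have "st (\<lambda>u\<in>U. r) = {}" by (auto simp: st_def staircase_def)
    moreover have "(\<lambda>u\<in>U. r) \<in> E" by (auto simp: E_def)
    moreover have "A \<noteq> {}" using large[OF A] N by auto
    ultimately show ?thesis using A unfolding F_def by blast
  qed
  \<comment> \<open>The \<open>+ 1\<close> pays for the empty staircase, which is excluded from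
    \<open>F\<close>.\<close>
  have cardF: "R ^ n \<le> card F + 1"
  proof -
    have "R ^ n = card E" using fin by (simp add: E_def card_PiE R_def n_def)
    also have "\<dots> = card (st ` E)"
      unfolding st_def E_def by (rule card_image[OF inj_on_staircase, symmetric])
    also have "\<dots> \<le> card (insert {} F)"
      by (rule card_mono) (use finF in \<open>auto simp: F_def\<close>)
    also have "\<dots> \<le> card F + 1" using finF by (simp add: card_insert_if)
    finally show ?thesis .
  qed
  have rare: "r * card {B \<in> F. (u, 0) \<in> B} \<le> card F" if u: "u \<in> U" for u
  proof -
    \<comment> \<open>A member containing \<open>(u, 0)\<close> is a plain staircase with
      \<open>c u = 0\<close>, coded by \<open>Q\<close>, or a union with some \<open>A\<close> in
      \<open>S\<close>, coded by \<open>P A\<close> after the merging of states. All of the latter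
      are counted, even those without \<open>(u, 0)\<close>.\<close>
    define P where "P A = PiE U (\<lambda>v. if v \<in> A then {1..r} else {..r})" for A
    define Q where "Q = PiE U (\<lambda>v. if v \<in> {u} then {0} else {..r})"
    have sub: "{B \<in> F. (u, 0) \<in> B} \<subseteq> st ` Q \<union> (\<Union>A\<in>S. (\<lambda>c. st c \<union> A \<times> {0}) ` P A)"
    proof
      fix B assume "B \<in> {B \<in> F. (u, 0) \<in> B}"
      then obtain c A where B: "B = st c \<union> A \<times> {0}" "c \<in> E" "A \<in> insert {} S" "(u, 0) \<in> B"
        unfolding F_def by blast
      show "B \<in> st ` Q \<union> (\<Union>A\<in>S. (\<lambda>c. st c \<union> A \<times> {0}) ` P A)"
      proof (cases "A \<in> S")
        case True
        define d where "d = (\<lambda>v\<in>U. if v \<in> A then max 1 (c v) else c v)"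
        have "B = st d \<union> A \<times> {0}"
          unfolding B(1) st_def d_def using True SU r by (intro staircase_Un_bottom) auto
        moreover have "d \<in> P A" using B(2) r by (auto simp: P_def d_def E_def PiE_def Pi_def)
        ultimately show ?thesis using True by blast
      next
        case False
        hence "B = st c" "c u = 0" using B by (auto simp: st_def staircase_def)
        moreover from this have "c \<in> Q" using B(2) by (auto simp: Q_def E_def PiE_def Pi_def)
        ultimately show ?thesis by blast
      qed
    qed
    have finP: "finite (P A)" and finQ: "finite Q" for A
      using fin by (auto simp: P_def Q_def intro!: finite_PiE)
    have cP: "card (P A) \<le> r ^ N * R ^ (n - N)" if A: "A \<in> S" for A
    proof -
      have AU: "A \<subseteq> U" using A SU by auto
      have "card A \<le> n" using AU fin by (simp add: card_mono n_def)
      have "card (P A) = r ^ card A * R ^ (n - card A)"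
        unfolding P_def card_PiE_if[OF fin AU] by (simp add: R_def n_def)
      also have "\<dots> = r ^ N * (r ^ (card A - N) * R ^ (n - card A))"
        using large[OF A] by (simp add: power_add[symmetric])
      \<comment> \<open>The saving from \<open>R\<close> to \<open>r\<close> is kept at
        \<open>N\<close> coordinates only, which makes the bound independent of
        \<open>A\<close>.\<close>
      also have "\<dots> \<le> r ^ N * (R ^ (card A - N) * R ^ (n - card A))"
        by (intro mult_mono power_mono) (auto simp: R_def)
      also have "\<dots> = r ^ N * R ^ (n - N)"
        using large[OF A] \<open>card A \<le> n\<close> by (simp add: power_add[symmetric])
      finally show ?thesis .
    qed
    have cQ: "card Q = R ^ (n - 1)"
      unfolding Q_def using u by (subst card_PiE_if[OF fin]) (auto simp: R_def n_def)
    have "card {B \<in> F. (u, 0) \<in> B} \<le> card (st ` Q \<union> (\<Union>A\<in>S. (\<lambda>c. st c \<union> A \<times> {0}) ` P A))"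
      by (rule card_mono[OF _ sub]) (use finS finP finQ in auto)
    also have "\<dots> \<le> card (st ` Q) + card (\<Union>A\<in>S. (\<lambda>c. st c \<union> A \<times> {0}) ` P A)"
      by (rule card_Un_le)
    also have "\<dots> \<le> card Q + (\<Sum>A\<in>S. card ((\<lambda>c. st c \<union> A \<times> {0}) ` P A))"
      by (intro add_mono card_image_le finQ card_UN_le finS)
    also have "\<dots> \<le> card Q + (\<Sum>A\<in>S. card (P A))"
      by (intro add_left_mono sum_mono card_image_le finP)
    also have "\<dots> \<le> R ^ (n - 1) + (\<Sum>A\<in>S. r ^ N * R ^ (n - N))"
      unfolding cQ by (intro add_left_mono sum_mono cP)
    finally have c1: "card {B \<in> F. (u, 0) \<in> B} \<le> R ^ (n - 1) + card S * (r ^ N * R ^ (n - N))"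
      by simp
    \<comment> \<open>\<open>T\<close> is \<open>r\<close> times the bound on the unions. As
      \<open>card F\<close> is at least \<open>r * R ^ (n - 1) + R ^ (n - 1) - 1\<close>, it
      suffices that \<open>T \<le> R ^ (n - 1) - 1\<close>. This follows from
      \<open>2 * T \<le> R ^ (n - 1)\<close> and \<open>2 \<le> R ^ (n - 1)\<close>, whence the
      factor \<open>2\<close> in \<open>few\<close> and the condition
      \<open>N \<ge> 2\<close>.\<close>
    define T where "T = r * (card S * (r ^ N * R ^ (n - N)))"
    have Rn: "R ^ n = R * R ^ (n - 1)" using Nn N by (metis One_nat_def Suc_diff_1 Suc_le_lessD
          le_trans one_le_numeral power_Suc)
    have "R * (2 * T) = (2 * card S * r * (r + 1) * r ^ N) * R ^ (n - N)"
      unfolding T_def R_def by (simp only: mult_ac)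
    also have "\<dots> \<le> R ^ N * R ^ (n - N)" using few by (simp add: R_def)
    also have "\<dots> = R * R ^ (n - 1)" using Nn Rn by (simp add: power_add[symmetric])
    finally have T: "2 * T \<le> R ^ (n - 1)"
      by (rule mult_le_cancel1[THEN iffD1, rule_format]) (simp add: R_def)
    have "2 \<le> R" using r by (simp add: R_def)
    also have "R \<le> R ^ (n - 1)" using N Nn by (intro self_le_power) (auto simp: R_def)
    finally have two: "2 \<le> R ^ (n - 1)" .
    have "r * card {B \<in> F. (u, 0) \<in> B} \<le> r * R ^ (n - 1) + T"
      using mult_le_mono2[OF c1, of r] by (simp add: T_def distrib_left)
    also have "\<dots> \<le> card F"
    proof -
      have "R ^ n = r * R ^ (n - 1) + R ^ (n - 1)" unfolding Rn by (simp add: R_def)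
      thus ?thesis using T two cardF by linarith
    qed
    finally show ?thesis .
  qed
  show ?thesis
    proof (rule that[OF FX])
    show "{} \<notin> F" by (simp add: F_def)
    show "F \<noteq> {}" using old[OF A0] by blast
  qed (intro ballI FU old rare; assumption)+
qed

section \<open>Transport and addition of weights\<close>

text \<open>The pushforward of a weight: summing over fibres preserves totals even without
  injectivity and gives \<open>0\<close> off the image.\<close>

definition push :: "('a set \<Rightarrow> 'b set) \<Rightarrow> 'a set \<Rightarrow> ('a set \<Rightarrow> real) \<Rightarrow> 'b set \<Rightarrow> real" where
  "push h V w B = (\<Sum>C\<in>{C \<in> Pow V. h C = B}. w C)"

lemma push_image:
  assumes "inj_on h (Pow V)" "C \<subseteq> V"
  shows "push h V w (h C) = w C"
proof -
  have "{D \<in> Pow V. h D = h C} = {C}" using assms by (auto dest: inj_onD)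
  thus ?thesis by (simp add: push_def)
qed

lemma push_outside: "B \<notin> h ` Pow V \<Longrightarrow> push h V w B = 0"
  unfolding push_def by (rule sum.neutral) auto

lemma sum_push:
  assumes "finite V" "finite X" "h ` Pow V \<subseteq> Pow X"
  shows "(\<Sum>B\<in>{B \<in> Pow X. P B}. push h V w B) = (\<Sum>C\<in>{C \<in> Pow V. P (h C)}. w C)"
proof -
  have "(\<Sum>C\<in>{C \<in> Pow V. P (h C)}. w C) =
      (\<Sum>B\<in>{B \<in> Pow X. P B}. \<Sum>C\<in>{C \<in> {C \<in> Pow V. P (h C)}. h C = B}. w C)"
    by (rule sum.group[symmetric]) (use assms in auto)
  also have "\<dots> = (\<Sum>B\<in>{B \<in> Pow X. P B}. push h V w B)"
    unfolding push_def by (intro sum.cong) auto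
  finally show ?thesis ..
qed

text \<open>The union inequality has content only if both sets lie in the image, where
  \<open>h\<close> respects unions; otherwise one of the two weights is \<open>0\<close>.\<close>

lemma admissible_push:
  assumes adm: "admissible V w" and inj: "inj_on h (Pow V)" and sub: "h ` Pow V \<subseteq> Pow X"
    and h0: "h {} = {}" and hU: "\<And>C D. C \<subseteq> V \<Longrightarrow> D \<subseteq> V \<Longrightarrow> h (C \<union> D) = h C \<union> h D"
  shows "admissible X (push h V w)"
proof -
  have nonneg: "0 \<le> push h V w B" for B
    using adm unfolding push_def admissible_def by (intro sum_nonneg) auto
  show ?thesis
    unfolding admissible_def
  proof (intro conjI ballI)
    obtain A where "A \<in> Pow V" "w A \<noteq> 0" using adm by (auto simp: admissible_def)
    thus "\<exists>A\<in>Pow X. push h V w A \<noteq> 0"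
      using sub push_image[OF inj, of A w] by (intro bexI[of _ "h A"]) auto
    show "push h V w {} = 0"
      using push_image[OF inj, of "{}" w] h0 adm by (simp add: admissible_def)
    fix A B
    show "min (push h V w A) (push h V w B) \<le> push h V w (A \<union> B)"
    proof (cases "A \<in> h ` Pow V \<and> B \<in> h ` Pow V")
      case True
      then obtain C D where "C \<subseteq> V" "D \<subseteq> V" "A = h C" "B = h D" by auto
      thus ?thesis
        using adm hU[of C D, symmetric] by (simp add: push_image[OF inj] admissible_def)
    next
      case False
      thus ?thesis using nonneg[of A] nonneg[of B] nonneg[of "A \<union> B"] push_outside[of _ h V w]
        by (auto simp: min_le_iff_disj)
    qed
  qed (use nonneg in auto)
qed

text \<open>For \<open>A\<close> and \<open>B\<close> in \<open>F\<close> both sides gain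
  \<open>c\<close>. Otherwise, by \<open>supp\<close>, one of the two sets has weight
  \<open>0\<close> before and after, so the minimum is at most \<open>0\<close>. This is why the
  levels are nested.\<close>

lemma admissible_add_family:
  assumes adm: "admissible X w" and c: "c \<ge> 0"
    and F: "{} \<notin> F" "\<And>A B. A \<in> F \<Longrightarrow> B \<in> F \<Longrightarrow> A \<union> B \<in> F"
    and supp: "\<And>A. A \<subseteq> X \<Longrightarrow> w A \<noteq> 0 \<Longrightarrow> A \<in> F"
  shows "admissible X (\<lambda>A. w A + (if A \<in> F then c else 0))"
proof -
  have nonneg: "0 \<le> w A" if "A \<subseteq> X" for A using adm that by (auto simp: admissible_def)
  show ?thesis
    unfolding admissible_def
  proof (intro conjI ballI)
    obtain A where "A \<subseteq> X" "w A \<noteq> 0" using adm by (auto simp: admissible_def)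
    thus "\<exists>A\<in>Pow X. w A + (if A \<in> F then c else 0) \<noteq> 0"
      using c nonneg[of A] by (intro bexI[of _ A]) (auto simp: add_nonneg_eq_0_iff)
    show "w {} + (if {} \<in> F then c else 0) = 0" using adm F by (simp add: admissible_def)
    fix A B assume AB: "A \<in> Pow X" "B \<in> Pow X"
    hence "min (w A) (w B) \<le> w (A \<union> B)" using adm by (auto simp: admissible_def)
    moreover have "A \<in> F \<or> w A = 0" "B \<in> F \<or> w B = 0" using supp AB by blast+
    ultimately show "min (w A + (if A \<in> F then c else 0)) (w B + (if B \<in> F then c else 0))
        \<le> w (A \<union> B) + (if A \<union> B \<in> F then c else 0)"
      using AB F(2)[of A B] nonneg[of "A \<union> B"] c
      by (cases "A \<in> F"; cases "B \<in> F") (auto simp: min_le_iff_disj)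
  qed (use nonneg c in auto)
qed

section \<open>Adding one level\<close>

lemma exists_power_dominating:
  fixes r K :: nat
  assumes "r \<ge> 1"
  obtains N where "N \<ge> 2" "K * r ^ N \<le> (r + 1) ^ N"
proof -
  define q where "q = real (r + 1) / real r"
  have q: "1 < q" using assms by (simp add: q_def)
  obtain n where n: "real K < q ^ n" using real_arch_pow[OF q] by blast
  \<comment> \<open>The exponent is raised by \<open>2\<close> to ensure
    \<open>N \<ge> 2\<close>.\<close>
  have "q ^ n \<le> q ^ (n + 2)" using q by (intro power_increasing) auto
  with n have "real K \<le> real (r + 1) ^ (n + 2) / real r ^ (n + 2)"
    by (simp add: q_def power_divide)
  hence "real K * real r ^ (n + 2) \<le> real (r + 1) ^ (n + 2)"
    using assms by (subst (asm) pos_le_divide_eq) auto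
  hence "K * r ^ (n + 2) \<le> (r + 1) ^ (n + 2)"
    by (metis of_nat_le_iff of_nat_mult of_nat_power)
  thus ?thesis by (intro that[of "n + 2"]) auto
qed

text \<open>Sums stay unnormalised, so that a level of mass \<open>1\<close> is simply added. A
  bottom element inherits at most \<open>b\<close> and gains at most \<open>1 / r\<close>; any other
  element lies in no transported set and gains at most \<open>1\<close>. Hence the maximum.\<close>

lemma add_level:
  fixes V :: "nat set" and r :: nat
  assumes fin: "finite V" and adm: "admissible V w" and r: "r \<ge> 1"
    and bound: "\<And>x. x \<in> V \<Longrightarrow> (\<Sum>A\<in>{A \<in> Pow V. x \<in> A}. w A) \<le> b" and b: "b \<ge> 0"
  obtains X :: "((nat \<times> nat) \<times> nat) set" and w' where "finite X" "admissible X w'"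
    "(\<Sum>A\<in>Pow X. w' A) = (\<Sum>A\<in>Pow V. w A) + 1"
    "\<forall>x\<in>X. (\<Sum>A\<in>{A \<in> Pow X. x \<in> A}. w' A) \<le> max (b + 1 / real r) 1"
proof -
  define S0 where "S0 = {C \<in> Pow V. w C \<noteq> 0}"
  \<comment> \<open>\<open>N\<close> is chosen from the support before the blow-up;
    \<open>bl\<close> does not increase the number of sets, so the same \<open>N\<close> serves the
    image of \<open>S0\<close>.\<close>
  obtain N where N: "N \<ge> 2"
    and pow: "(2 * card S0 * r * (r + 1)) * r ^ N \<le> (r + 1) ^ N"
    using exists_power_dominating[OF r] by blast
  define U where "U = V \<times> {..<N}"
  define bl where "bl C = C \<times> {..<N}" for C :: "nat set"
  define X where "X = U \<times> {..<r}"
  define h where "h C = bl C \<times> {0::nat}" for C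
  have finS0: "finite S0" using fin by (simp add: S0_def)
  have S0_card: "card (bl ` S0) \<le> card S0" by (rule card_image_le[OF finS0])
  have S0_ne: "bl ` S0 \<noteq> {}" using adm by (auto simp: S0_def admissible_def)
  have S0_un: "C \<union> D \<in> S0" if "C \<in> S0" "D \<in> S0" for C D
  proof -
    have "0 < w C" "0 < w D" "min (w C) (w D) \<le> w (C \<union> D)"
      using that adm unfolding S0_def admissible_def by (auto simp: less_le)
    thus ?thesis using that by (auto simp: S0_def)
  qed
  have large: "N \<le> card A" if A: "A \<in> bl ` S0" for A
  proof -
    obtain C where C: "C \<in> S0" "A = bl C" using A by blast
    have "C \<noteq> {}" "finite C" using C adm fin by (auto simp: S0_def admissible_def finite_subset)
    hence "card C \<ge> 1" by (simp add: Suc_leI card_gt_0_iff)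
    thus ?thesis using C by (simp add: bl_def card_cartesian_product)
  qed
  have "2 * card (bl ` S0) * r * (r + 1) * r ^ N \<le> 2 * card S0 * r * (r + 1) * r ^ N"
    using S0_card by (intro mult_mono) auto
  hence few: "2 * card (bl ` S0) * r * (r + 1) * r ^ N \<le> (r + 1) ^ N" using pow by linarith
  have bl_un: "A \<union> B \<in> bl ` S0" if A: "A \<in> bl ` S0" and B: "B \<in> bl ` S0" for A B
  proof -
    obtain C D where CD: "C \<in> S0" "D \<in> S0" "A = bl C" "B = bl D" using A B by blast
    hence "A \<union> B = bl (C \<union> D)" by (auto simp: bl_def)
    thus ?thesis using S0_un[OF CD(1,2)] by blast
  qed
  have finU: "finite U" and blU: "bl ` S0 \<subseteq> Pow U"
    using fin by (auto simp: U_def bl_def S0_def)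
  obtain F where F: "F \<subseteq> Pow X" "{} \<notin> F" "F \<noteq> {}"
    "\<forall>A\<in>F. \<forall>B\<in>F. A \<union> B \<in> F" "\<forall>A\<in>bl ` S0. A \<times> {0} \<in> F"
    "\<forall>u\<in>U. r * card {B \<in> F. (u, 0) \<in> B} \<le> card F"
    unfolding X_def
    by (rule rare_bottom_family[OF finU blU S0_ne bl_un r N large few]) (assumption | rule that)+
  have finX: "finite X" using fin by (simp add: X_def U_def)
  have finF: "finite F" using F(1) finX by (meson finite_Pow_iff finite_subset)
  have inj: "inj_on h (Pow V)"
  proof (rule inj_onI)
    fix C D assume eq: "h C = h D"
    have "x \<in> E \<longleftrightarrow> ((x, 0), 0) \<in> h E" for x E using N by (auto simp: h_def bl_def)
    thus "C = D" using eq by blast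
  qed
  have hsub: "h ` Pow V \<subseteq> Pow X" using r by (auto simp: h_def bl_def X_def U_def)
  define v where "v = push h V w"
  \<comment> \<open>Equal weights on \<open>F\<close> that give the new level total mass
    \<open>1\<close>.\<close>
  define c where "c = 1 / real (card F)"
  define w' where "w' A = v A + (if A \<in> F then c else 0)" for A
  have cF: "real (card F) > 0" using F(3) finF by (simp add: card_gt_0_iff)
  have c: "c \<ge> 0" by (simp add: c_def)
  have supp: "A \<in> F" if "v A \<noteq> 0" for A
  proof -
    have "A \<in> h ` Pow V" using that push_outside[of A h V w] unfolding v_def by blast
    then obtain C where C: "C \<subseteq> V" "A = h C" by blast
    hence "C \<in> S0" using that push_image[OF inj, of C w] by (simp add: S0_def v_def)
    thus ?thesis using F(5) C by (simp add: h_def)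
  qed
  have admv: "admissible X v"
    unfolding v_def by (rule admissible_push[OF adm inj hsub]) (auto simp: h_def bl_def)
  have adm': "admissible X w'"
    unfolding w'_def by (rule admissible_add_family[OF admv c F(2) F(4)[rule_format] supp])
  have sumF: "(\<Sum>A\<in>{A \<in> Pow X. P A}. w' A) =
      (\<Sum>C\<in>{C \<in> Pow V. P (h C)}. w C) + c * real (card {A \<in> F. P A})" for P
  proof -
    have "(\<Sum>A\<in>{A \<in> Pow X. P A}. if A \<in> F then c else 0) = (\<Sum>A\<in>{A \<in> F. P A}. c)"
      using F(1) finX by (intro sum.mono_neutral_cong_right) auto
    thus ?thesis
      unfolding w'_def sum.distrib v_def sum_push[OF fin finX hsub] by simp
  qed
  have total: "(\<Sum>A\<in>Pow X. w' A) = (\<Sum>A\<in>Pow V. w A) + 1"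
  proof -
    have "c * real (card F) = 1" using cF by (simp add: c_def)
    thus ?thesis using sumF[of "\<lambda>_. True"] by (simp add: Pow_def)
  qed
  have "(\<Sum>A\<in>{A \<in> Pow X. x \<in> A}. w' A) \<le> max (b + 1 / real r) 1" if x: "x \<in> X" for x
  proof -
    obtain a i j where xe: "x = ((a, i), j)" by (metis prod.exhaust)
    have m: "a \<in> V" "i < N" using x by (auto simp: xe X_def U_def)
    show ?thesis
    proof (cases "j = 0")
      case True
      \<comment> \<open>A bottom copy of \<open>a\<close> lies in exactly those transported sets
        that come from sets containing \<open>a\<close>, so the old bound carries over.\<close>
      have "x \<in> h C \<longleftrightarrow> a \<in> C" for C using m True by (auto simp: xe h_def bl_def)
      hence "(\<Sum>C\<in>{C \<in> Pow V. x \<in> h C}. w C) \<le> b" using bound[OF m(1)] by simp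
      moreover have "real r * real (card {A \<in> F. x \<in> A}) \<le> real (card F)"
        using F(6)[rule_format, of "(a, i)"] m True unfolding of_nat_mult[symmetric] of_nat_le_iff
        by (simp add: xe U_def)
      hence "c * real (card {A \<in> F. x \<in> A}) \<le> 1 / real r"
        using cF r by (simp add: c_def field_simps)
      ultimately show ?thesis unfolding sumF by linarith
    next
      case False
      hence e: "{C \<in> Pow V. x \<in> h C} = {}" by (auto simp: xe h_def)
      have "card {A \<in> F. x \<in> A} \<le> card F" using finF by (intro card_mono) auto
      hence "c * real (card {A \<in> F. x \<in> A}) \<le> 1" using cF by (simp add: c_def)
      thus ?thesis unfolding sumF e by (simp add: le_max_iff_disj)
    qed
  qed
  thus ?thesis by (intro that[OF finX adm' total] ballI)
qed

section \<open>Induction on the levels and normalisation\<close>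

text \<open>Here \<open>m\<close> counts the levels added to an initial one, which is
  \<open>{0}\<close> with weight \<open>1\<close>. Each addition raises the total by
  \<open>1\<close> and the bound by \<open>1 / r\<close>.\<close>

lemma levels_exist:
  fixes r m :: nat
  assumes r: "r \<ge> 1"
  shows "\<exists>(V :: nat set) w. finite V \<and> admissible V w \<and> (\<Sum>A\<in>Pow V. w A) = real (m + 1) \<and>
    (\<forall>x\<in>V. (\<Sum>A\<in>{A \<in> Pow V. x \<in> A}. w A) \<le> 1 + real m / real r)"
proof (induction m)
  case 0
  define w :: "nat set \<Rightarrow> real" where "w A = (if A = {0} then 1 else 0)" for A
  have P: "Pow {0::nat} = {{}, {0}}" by auto
  have "admissible {0} w" by (auto simp: admissible_def w_def P)
  moreover have "{A. A \<subseteq> {0::nat} \<and> 0 \<in> A} = {{0}}" by auto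
  ultimately show ?case by (intro exI[of _ "{0}"] exI[of _ w]) (simp add: P, simp add: w_def)
next
  case (Suc m)
  then obtain V :: "nat set" and w where V: "finite V" "admissible V w"
    "(\<Sum>A\<in>Pow V. w A) = real (m + 1)"
    "\<And>x. x \<in> V \<Longrightarrow> (\<Sum>A\<in>{A \<in> Pow V. x \<in> A}. w A) \<le> 1 + real m / real r" by blast
  define b where "b = 1 + real m / real r"
  have b: "b \<ge> 0" by (simp add: b_def)
  obtain X :: "((nat \<times> nat) \<times> nat) set" and w' where X: "finite X" "admissible X w'"
    "(\<Sum>A\<in>Pow X. w' A) = (\<Sum>A\<in>Pow V. w A) + 1"
    "\<forall>x\<in>X. (\<Sum>A\<in>{A \<in> Pow X. x \<in> A}. w' A) \<le> max (b + 1 / real r) 1"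
    by (rule add_level[OF V(1,2) r V(4)[folded b_def] b]) (assumption | rule that)+
  \<comment> \<open>The new ground set consists of nested pairs; coding them into \<open>nat\<close>
    keeps the type fixed through the induction.\<close>
  define f :: "(nat \<times> nat) \<times> nat \<Rightarrow> nat" where "f = to_nat"
  have injf: "inj f" by (simp add: f_def)
  have inj: "inj_on ((`) f) (Pow X)" by (rule inj_on_image_Pow) (rule inj_on_subset[OF injf subset_UNIV])
  have sub: "(`) f ` Pow X \<subseteq> Pow (f ` X)" by auto
  have fin: "finite (f ` X)" using X by simp
  define u where "u = push ((`) f) X w'"
  have sums: "(\<Sum>A\<in>{A \<in> Pow (f ` X). P A}. u A) = (\<Sum>A\<in>{A \<in> Pow X. P (f ` A)}. w' A)" for P
    unfolding u_def by (rule sum_push[OF X(1) fin sub])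
  have "admissible (f ` X) u"
    unfolding u_def by (rule admissible_push[OF X(2) inj sub]) auto
  moreover have "(\<Sum>A\<in>Pow (f ` X). u A) = real (Suc m + 1)"
    using sums[of "\<lambda>_. True"] X(3) V(3) by (simp add: Pow_def)
  moreover have "(\<Sum>A\<in>{A \<in> Pow (f ` X). y \<in> A}. u A) \<le> 1 + real (Suc m) / real r"
    if y: "y \<in> f ` X" for y
  proof -
    obtain x where x: "x \<in> X" "y = f x" using y by blast
    have "(\<Sum>A\<in>{A \<in> Pow (f ` X). y \<in> A}. u A) = (\<Sum>A\<in>{A \<in> Pow X. x \<in> A}. w' A)"
      unfolding sums x(2) inj_image_mem_iff[OF injf] ..
    also have "\<dots> \<le> max (b + 1 / real r) 1" using X(4) x(1) by blast
    \<comment> \<open>The maximum is its first argument because \<open>b \<ge> 1\<close>.\<close>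
    also have "\<dots> = 1 + real (Suc m) / real r" by (simp add: b_def add_divide_distrib)
    finally show ?thesis .
  qed
  ultimately show ?case using fin by blast
qed

theorem theorem1p4:
  fixes r m :: int
  assumes "r \<ge> 2" and "m \<ge> 1"
  shows "\<exists>(V :: nat set) (w :: nat set \<Rightarrow> real).
           finite V \<and> admissible V w \<and>
           max_frequency V w
             \<le> 1 / real_of_int m + (real_of_int m - 1) / (real_of_int m * real_of_int r)"
proof -
  define r' where "r' = nat r"
  \<comment> \<open>\<open>k\<close> added levels make \<open>k + 1 = m\<close> levels in all, so
    the total weight is \<open>m\<close>.\<close>
  define k where "k = nat (m - 1)"
  have re: "real r' = real_of_int r" and ke: "real k = real_of_int m - 1"
    using assms by (auto simp: r'_def k_def)
  have "r' \<ge> 1" using assms by (simp add: r'_def)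
  then obtain V :: "nat set" and w where V: "finite V" "admissible V w"
    "(\<Sum>A\<in>Pow V. w A) = real (k + 1)"
    "\<And>x. x \<in> V \<Longrightarrow> (\<Sum>A\<in>{A \<in> Pow V. x \<in> A}. w A) \<le> 1 + real k / real r'"
    using levels_exist[of r' k] by blast
  have ne: "V \<noteq> {}" using V(2) by (auto simp: admissible_def)
  have tot: "(\<Sum>A\<in>Pow V. w A) = real_of_int m" using V(3) ke by simp
  have "frequency V w x \<le> 1 / real_of_int m + (real_of_int m - 1) / (real_of_int m * real_of_int r)"
    if "x \<in> V" for x
  proof -
    have "frequency V w x \<le> (1 + (real_of_int m - 1) / real_of_int r) / real_of_int m"
      unfolding frequency_def tot using V(4)[OF that] assms
      by (intro divide_right_mono) (auto simp: re ke)
    also have "\<dots> = 1 / real_of_int m + (real_of_int m - 1) / (real_of_int m * real_of_int r)"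
      by (simp add: add_divide_distrib mult.commute)
    finally show ?thesis .
  qed
  hence "max_frequency V w
      \<le> 1 / real_of_int m + (real_of_int m - 1) / (real_of_int m * real_of_int r)"
    unfolding max_frequency_def using V(1) ne by (subst Max_le_iff) auto
  thus ?thesis using V(1,2) by blast
qed

end
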